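(* Let $(S,\mathcal{A},\mu)$ be a complete, finite measure space, $1\leq p<\infty$ and $X$ a Banach space with the uniform Opial property. Let $M,R>0$ and $f\in L^p(\mu,X)\setminus\{0\}$. Then there exists $\eta>0$ such that the following holds: whenever $(f_n)_{n\in\mathbb{N}}$ is a sequence in $L^p(\mu,X)$ with $\sup_{n\in\mathbb{N}}\|f_n\|_p\leq R$ such that, for almost every $t\in S$, $(f_n(t))_{n\in\mathbb{N}}$ converges weakly to zero and $\lim_{n\to\infty}\|f_n(t)\|$ exists and is at most $M$, then $$\limsup_{n\to\infty}\|f_n\|_p+\eta\leq\limsup_{n\to\infty}\|f_n-f\|_p.$$
   Context: All Banach spaces are real. The Lebesgue-Bochner space $L^p(\mu,X)$ is the space of all Bochner-measurable functions $f:S\to X$ (modulo equality $\mu$-almost everywhere) with $\|f(\cdot)\|\in L^p(\mu)$, normed by $\|f\|_p:=\|\,\|f(\cdot)\|\,\|_p$. A Banach space $X$ has the uniform Opial property if for every $c>0$ there is some $r>0$ such that $1+r\leq\liminf_{n\to\infty}\|x_n-x\|$ for every $x\in X$ with $\|x\|\geq c$ and every weakly null sequence $(x_n)_{n\in\mathbb{N}}$ in $X$ with $\liminf_{n\to\infty}\|x_n\|\geq 1$. Equivalently: for every $\varepsilon>0$ and $R>0$ there is some $\eta>0$ such that $\eta+\liminf_{n\to\infty}\|x_n\|\leq\liminf_{n\to\infty}\|x_n-x\|$ for all $x\in X$ with $\|x\|\geq\varepsilon$ and every weakly null sequence $(x_n)_{n\in\mathbb{N}}$ in $X$ with $\limsup_{n\to\infty}\|x_n\|\leq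 R$. *)

theory Defs
  imports "HOL-Analysis.Analysis"
begin

definition weakly_null :: "(nat \<Rightarrow> 'b::real_normed_vector) \<Rightarrow> bool" where
  "weakly_null x \<longleftrightarrow>
     (\<forall>\<phi> :: 'b \<Rightarrow>\<^sub>L real. (\<lambda>n. blinfun_apply \<phi> (x n)) \<longlonglongrightarrow> 0)"

(* The limit inferior is taken in the extended reals: on the type real it is
   only meaningful for bounded sequences, and the definition should not depend
   on weakly null sequences being bounded. *)
definition uniform_Opial :: "'b::banach itself \<Rightarrow> bool" where
  "uniform_Opial _ \<longleftrightarrow>
     (\<forall>c>0. \<exists>r>0. \<forall>(x::'b) (xs::nat \<Rightarrow> 'b).
        c \<le> norm x \<longrightarrow> weakly_null xs \<longrightarrow>
        1 \<le> liminf (\<lambda>n. ereal (norm (xs n))) \<longrightarrow>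
        ereal (1 + r) \<le> liminf (\<lambda>n. ereal (norm (xs n - x))))"

(* On a non-separable space Borel measurability need not imply Bochner
   (strong) measurability, so borel_measurable cannot be used here. *)
definition Bochner_measurable :: "'s measure \<Rightarrow> ('s \<Rightarrow> 'b::real_normed_vector) \<Rightarrow> bool" where
  "Bochner_measurable \<mu> f \<longleftrightarrow>
     (\<exists>s :: nat \<Rightarrow> 's \<Rightarrow> 'b. (\<forall>n. simple_function \<mu> (s n)) \<and>
        (AE t in \<mu>. (\<lambda>n. s n t) \<longlonglongrightarrow> f t))"

(* Elements are representatives, not classes modulo equality almost everywhere. *)
definition Lp_space :: "real \<Rightarrow> 's measure \<Rightarrow> ('s \<Rightarrow> 'b::real_normed_vector) set" where
  "Lp_space p \<mu> =
     {f. Bochner_measurable \<mu> f \<and> integrable \<mu> (\<lambda>t. norm (f t) powr p)}"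

definition Lp_norm :: "real \<Rightarrow> 's measure \<Rightarrow> ('s \<Rightarrow> 'b::real_normed_vector) \<Rightarrow> real" where
  "Lp_norm p \<mu> f = (\<integral>t. norm (f t) powr p \<partial>\<mu>) powr (1 / p)"

end

theory Submission
  imports Defs
begin

text \<open>
  The hypotheses give no domination of \<open>\<parallel>f\<^sub>n(\<cdot>)\<parallel>\<close>, so the pointwise gap provided by
  the Opial property cannot be integrated by dominated convergence; Fatou's lemma applied to
  a corrected integrand replaces it.

  Write \<open>a\<^sub>n = \<parallel>f\<^sub>n(\<cdot>)\<parallel>\<close> and \<open>b\<^sub>n = \<parallel>f\<^sub>n(\<cdot>) - f(\<cdot>)\<parallel>\<close>. Rescaling a weakly null sequence
  by the limit of its norms turns the uniform Opial property into an additive gap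
  (\<open>uniform_Opial_eventually_gap\<close>): there is a \<open>\<delta> > 0\<close>, depending only on \<open>c\<close> and \<open>M\<close>, such
  that at almost every \<open>t\<close> with \<open>\<parallel>f(t)\<parallel> \<ge> c\<close> one has \<open>a\<^sub>n + \<delta> \<le> b\<^sub>n\<close> for all large \<open>n\<close>. As \<open>f\<close>
  is not zero, some \<open>c > 0\<close> makes \<open>E = {\<parallel>f(\<cdot>)\<parallel> \<ge> c}\<close> a set of positive measure. Since
  \<open>x\<^sup>p + y\<^sup>p \<le> (x + y)\<^sup>p\<close>, it follows that \<open>a\<^sub>n\<^sup>p + h \<le> b\<^sub>n\<^sup>p\<close> eventually, at almost every
  point, where \<open>h\<close> is \<open>\<delta>\<^sup>p\<close> on \<open>E\<close> and \<open>0\<close> elsewhere.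

  The differences \<open>b\<^sub>n\<^sup>p - a\<^sub>n\<^sup>p\<close> may be negative without an integrable minorant, but by
  \<open>powr_add_le_weighted\<close> the functions
  \<open>(1 + \<theta>)\<^sup>p b\<^sub>n\<^sup>p - a\<^sub>n\<^sup>p + (1 + 1/\<theta>)\<^sup>p \<parallel>f(\<cdot>)\<parallel>\<^sup>p\<close> are nonnegative for every \<open>\<theta> > 0\<close>. Fatou's
  lemma gives the gap \<open>\<integral>h\<close> for their integrals, and the surplus \<open>((1 + \<theta>)\<^sup>p - 1) \<integral>b\<^sub>n\<^sup>p\<close>
  is as small as desired because \<open>\<integral>b\<^sub>n\<^sup>p\<close> is bounded. Hence \<open>\<integral>a\<^sub>n\<^sup>p + \<kappa> \<le> \<integral>b\<^sub>n\<^sup>p\<close> eventually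
  (\<open>eventually_integral_powr_gap\<close>) with a \<open>\<kappa> > 0\<close> that does not depend on the sequence.
  As \<open>\<parallel>f\<^sub>n\<parallel>\<^sub>p \<le> R\<close>, this gap of \<open>p\<close>-th powers yields a gap of the norms of size
  \<open>\<eta> = \<eta>(\<kappa>, p, R)\<close> (\<open>powr_gap_imp_gap\<close>).
\<close>

section \<open>Inequalities for powers\<close>

text \<open>
  The factor of \<open>b powr p\<close> can be brought arbitrarily close to \<open>1\<close> at the expense of the factor
  of \<open>s powr p\<close>. Whichever of \<open>s\<close> and \<open>\<theta> * b\<close> is larger, one of the two terms suffices.
\<close>
lemma powr_add_le_weighted:
  fixes b s \<theta> p :: real
  assumes "0 \<le> b" "0 \<le> s" "0 < \<theta>" "0 \<le> p"
  shows "(b + s) powr p \<le> (1 + \<theta>) powr p * b powr p + (1 + 1 / \<theta>) powr p * s powr p"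
proof (cases "s \<le> \<theta> * b")
  case True
  then have "(b + s) powr p \<le> ((1 + \<theta>) * b) powr p"
    using assms by (intro powr_mono2) (auto simp: algebra_simps)
  also have "\<dots> = (1 + \<theta>) powr p * b powr p"
    using assms by (simp add: powr_mult)
  finally show ?thesis
    by (simp add: add_increasing2)
next
  case False
  then have "b + s \<le> (1 + 1 / \<theta>) * s"
    using assms by (simp add: field_simps)
  then have "(b + s) powr p \<le> ((1 + 1 / \<theta>) * s) powr p"
    using assms by (intro powr_mono2) auto
  also have "\<dots> = (1 + 1 / \<theta>) powr p * s powr p"
    using assms by (simp add: powr_mult)
  finally show ?thesis
    by (simp add: add_increasing)
qed

lemma powr_add_ge:
  fixes x y p :: real
  assumes "0 \<le> x" "0 \<le> y" "1 \<le> p"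
  shows "x powr p + y powr p \<le> (x + y) powr p"
proof -
  have split: "z powr p = z * z powr (p - 1)" if "0 \<le> z" for z :: real
    using that powr_add[of z 1 "p - 1"] by (cases "z = 0") auto
  have "x * x powr (p - 1) \<le> x * (x + y) powr (p - 1)"
    and "y * y powr (p - 1) \<le> y * (x + y) powr (p - 1)"
    using assms by (auto intro!: mult_left_mono powr_mono2)
  then show ?thesis
    using assms by (simp add: split algebra_simps)
qed

lemma powr_factor_near_one:
  fixes p K \<epsilon> :: real
  assumes "0 < \<epsilon>"
  obtains \<theta> where "0 < \<theta>" "((1 + \<theta>) powr p - 1) * K \<le> \<epsilon>"
proof -
  have "((\<lambda>\<theta>. ((1 + \<theta>) powr p - 1) * K) \<longlongrightarrow> ((1 + 0) powr p - 1) * K) (at_right 0)"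
    by (intro tendsto_intros) auto
  then have "\<forall>\<^sub>F \<theta> in at_right 0. ((1 + \<theta>) powr p - 1) * K < \<epsilon>"
    by (rule order_tendstoD(2)) (use assms in simp)
  moreover have "\<forall>\<^sub>F \<theta> in at_right 0. (0::real) < \<theta>"
    by (rule eventually_at_right_less)
  ultimately have "\<forall>\<^sub>F \<theta> in at_right 0. 0 < \<theta> \<and> ((1 + \<theta>) powr p - 1) * K < \<epsilon>"
    by eventually_elim simp
  then obtain \<theta> where "0 < \<theta>" "((1 + \<theta>) powr p - 1) * K < \<epsilon>"
    using eventually_happens by force
  then show ?thesis
    by (intro that) auto
qed

text \<open>
  The uniform continuity of \<open>x \<mapsto> x\<^sup>p\<close> on bounded intervals, in the form that converts a gap
  between \<open>p\<close>-th powers into one between the numbers: \<open>powr_add_le_weighted\<close> bounds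
  \<open>(x + \<eta>) powr p\<close> by \<open>x powr p + \<kappa>\<close>. Half of \<open>\<kappa>\<close> covers \<open>((1 + \<theta>) powr p - 1) * x powr p\<close>,
  uniformly in \<open>x \<le> R\<close> for small \<open>\<theta>\<close>, and the other half the term with \<open>\<eta>\<close>.
\<close>
lemma powr_gap_imp_gap:
  fixes p R \<kappa> :: real
  assumes "1 \<le> p" "0 < \<kappa>"
  obtains \<eta> where "0 < \<eta>"
    "\<And>x y. 0 \<le> x \<Longrightarrow> x \<le> R \<Longrightarrow> 0 \<le> y \<Longrightarrow> x powr p + \<kappa> \<le> y powr p \<Longrightarrow> x + \<eta> \<le> y"
proof -
  obtain \<theta> where \<theta>: "0 < \<theta>" "((1 + \<theta>) powr p - 1) * R powr p \<le> \<kappa> / 2"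
    using powr_factor_near_one[of "\<kappa> / 2" p "R powr p"] assms by auto
  \<comment> \<open>chosen such that \<open>(1 + 1 / \<theta>) powr p * \<eta> powr p = \<kappa> / 2\<close>\<close>
  define \<eta> where "\<eta> = (\<kappa> / 2) powr (1 / p) / (1 + 1 / \<theta>)"
  have \<eta>: "0 < \<eta>"
    using assms \<theta> by (auto simp: \<eta>_def add_pos_pos)
  have \<eta>_powr: "(1 + 1 / \<theta>) powr p * \<eta> powr p = \<kappa> / 2"
  proof -
    have "0 < 1 + 1 / \<theta>"
      using \<theta> by (simp add: add_pos_pos)
    then have "(1 + 1 / \<theta>) * \<eta> = (\<kappa> / 2) powr (1 / p)"
      by (simp add: \<eta>_def)
    then have "((1 + 1 / \<theta>) * \<eta>) powr p = \<kappa> / 2"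
      using assms by (simp add: powr_powr)
    then show ?thesis
      using \<open>0 < 1 + 1 / \<theta>\<close> \<eta> by (simp add: powr_mult)
  qed
  show ?thesis
  proof (rule that[OF \<eta>])
    fix x y :: real
    assume x: "0 \<le> x" "x \<le> R" and y: "0 \<le> y" and gap: "x powr p + \<kappa> \<le> y powr p"
    have "(x + \<eta>) powr p \<le> (1 + \<theta>) powr p * x powr p + (1 + 1 / \<theta>) powr p * \<eta> powr p"
      using x \<eta> \<theta> assms by (intro powr_add_le_weighted) auto
    also have "\<dots> = x powr p + ((1 + \<theta>) powr p - 1) * x powr p + \<kappa> / 2"
      unfolding \<eta>_powr by (simp add: algebra_simps)
    also have "((1 + \<theta>) powr p - 1) * x powr p \<le> ((1 + \<theta>) powr p - 1) * R powr p"
      using x \<theta> assms by (intro mult_left_mono powr_mono2) (auto simp: ge_one_powr_ge_zero)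
    also have "x powr p + ((1 + \<theta>) powr p - 1) * R powr p + \<kappa> / 2 \<le> y powr p"
      using \<theta> gap by simp
    finally have "(x + \<eta>) powr p \<le> y powr p" by simp
    then show "x + \<eta> \<le> y"
      using x y \<eta> assms powr_less_mono2[of p y "x + \<eta>"] by force
  qed
qed

section \<open>The pointwise gap\<close>

lemma weakly_null_scaleR:
  assumes "weakly_null xs"
  shows "weakly_null (\<lambda>n. a *\<^sub>R xs n)"
  using assms tendsto_mult_right_zero[of _ sequentially a]
  by (auto simp: weakly_null_def blinfun.scaleR_right)

text \<open>
  The additive form of the uniform Opial property. Dividing the sequence by the limit \<open>l\<close> of its
  norms reduces to norms tending to \<open>1\<close>, with \<open>x\<close> replaced by \<open>x / l\<close> of norm at least \<open>c / M\<close>;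
  the gap \<open>r\<close> becomes \<open>l * r\<close> on scaling back, which is useless for small \<open>l\<close>. In that case the
  triangle inequality alone gives a gap comparable to \<open>c\<close>.
\<close>
lemma uniform_Opial_eventually_gap:
  fixes c M :: real
  assumes opial: "uniform_Opial TYPE('b::banach)" and "0 < c" "0 < M"
  obtains \<delta> where "0 < \<delta>"
    "\<And>(x::'b) xs l. c \<le> norm x \<Longrightarrow> weakly_null xs \<Longrightarrow> (\<lambda>n. norm (xs n)) \<longlonglongrightarrow> l \<Longrightarrow> l \<le> M
       \<Longrightarrow> \<forall>\<^sub>F n in sequentially. norm (xs n) + \<delta> \<le> norm (xs n - x)"
proof -
  obtain r where r: "0 < r" and gap: "\<And>(x::'b) xs. c / M \<le> norm x \<Longrightarrow> weakly_null xs \<Longrightarrow>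
        1 \<le> liminf (\<lambda>n. ereal (norm (xs n))) \<Longrightarrow>
        ereal (1 + r) \<le> liminf (\<lambda>n. ereal (norm (xs n - x)))"
    using opial \<open>0 < c\<close> \<open>0 < M\<close> unfolding uniform_Opial_def by (metis divide_pos_pos)
  \<comment> \<open>\<open>c / 3\<close> serves the case \<open>l \<le> c / 4\<close>; otherwise \<open>l * r > c * r / 4\<close>, and a quarter of
    \<open>l * r\<close> is what remains after half is lost to the limit inferior and a quarter to \<open>l\<close>\<close>
  define \<delta> where "\<delta> = min (c / 3) (c * r / 16)"
  show ?thesis
  proof (rule that[of \<delta>])
    show "0 < \<delta>"
      using \<open>0 < c\<close> r by (simp add: \<delta>_def)
    fix x :: 'b and xs :: "nat \<Rightarrow> 'b" and l
    assume x: "c \<le> norm x" and null: "weakly_null xs"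
      and lim: "(\<lambda>n. norm (xs n)) \<longlonglongrightarrow> l" and l: "l \<le> M"
    show "\<forall>\<^sub>F n in sequentially. norm (xs n) + \<delta> \<le> norm (xs n - x)"
    proof (cases "l \<le> c / 4")
      case True
      then have "\<forall>\<^sub>F n in sequentially. norm (xs n) < c / 3"
        using \<open>0 < c\<close> by (intro order_tendstoD(2)[OF lim]) auto
      then show ?thesis
      proof eventually_elim
        case (elim n)
        have "norm x \<le> norm (xs n - x) + norm (xs n)"
          using norm_triangle_ineq2[of x "xs n"] by (simp add: norm_minus_commute)
        moreover have "\<delta> \<le> c / 3" by (simp add: \<delta>_def)
        ultimately show ?case using elim x by linarith
      qed
    next
      case False
      then have "0 < l" using \<open>0 < c\<close> by simp
      define ys where "ys n = (1 / l) *\<^sub>R xs n" for n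
      have ys: "norm (ys n) = norm (xs n) / l"
        and ys_diff: "norm (ys n - (1 / l) *\<^sub>R x) = norm (xs n - x) / l" for n
        using \<open>0 < l\<close> by (simp_all add: ys_def flip: scaleR_diff_right)
      have "(\<lambda>n. norm (ys n)) \<longlonglongrightarrow> 1"
        unfolding ys using tendsto_divide[OF lim tendsto_const[of l]] \<open>0 < l\<close> by simp
      then have "liminf (\<lambda>n. ereal (norm (ys n))) = 1"
        by (intro lim_imp_Liminf) (auto simp: one_ereal_def)
      moreover have "c / M \<le> norm ((1 / l) *\<^sub>R x)"
        using \<open>0 < l\<close> \<open>0 < c\<close> l x frac_le[of "norm x" c l M] by simp
      moreover have "weakly_null ys"
        unfolding ys_def using null by (rule weakly_null_scaleR)
      ultimately have "ereal (1 + r) \<le> liminf (\<lambda>n. ereal (norm (ys n - (1 / l) *\<^sub>R x)))"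
        by (intro gap) simp_all
      then have "ereal (1 + r / 2) < liminf (\<lambda>n. ereal (norm (ys n - (1 / l) *\<^sub>R x)))"
        by (rule less_le_trans[rotated]) (use r in simp)
      then have "\<forall>\<^sub>F n in sequentially. ereal (1 + r / 2) < ereal (norm (ys n - (1 / l) *\<^sub>R x))"
        by (rule less_LiminfD)
      moreover have "\<forall>\<^sub>F n in sequentially. norm (xs n) < l + l * r / 4"
        using \<open>0 < l\<close> r by (intro order_tendstoD(2)[OF lim]) auto
      ultimately show ?thesis
      proof eventually_elim
        case (elim n)
        have "l + l * r / 2 < norm (xs n - x)"
          using elim(1) \<open>0 < l\<close> by (simp add: ys_diff field_simps)
        moreover have "c * r / 16 \<le> l * r / 4"
          using False r by (simp add: field_simps)
        moreover have "\<delta> \<le> c * r / 16" by (simp add: \<delta>_def)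
        ultimately show ?case using elim(2) by linarith
      qed
    qed
  qed
qed

section \<open>From a pointwise gap to a gap of integrals\<close>

text \<open>
  Fatou's lemma for \<open>b\<^sub>n\<^sup>p - a\<^sub>n\<^sup>p\<close>, made nonnegative as in the proof of the Brezis--Lieb lemma:
  \<open>a\<^sub>n \<le> b\<^sub>n + s\<close> gives \<open>a\<^sub>n\<^sup>p \<le> C b\<^sub>n\<^sup>p + D s\<^sup>p\<close> with \<open>C\<close> close to \<open>1\<close>. Passing from \<open>C b\<^sub>n\<^sup>p\<close> back
  to \<open>b\<^sub>n\<^sup>p\<close> costs \<open>(C - 1) \<integral>b\<^sub>n\<^sup>p\<close>, which is controlled because \<open>b\<^sub>n \<le> a\<^sub>n + s\<close> bounds these
  integrals uniformly.
\<close>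
lemma eventually_integral_powr_gap:
  fixes a b :: "nat \<Rightarrow> 's \<Rightarrow> real" and s h :: "'s \<Rightarrow> real" and p A \<kappa> :: real
  assumes p: "0 \<le> p"
    and nonneg: "\<And>n t. 0 \<le> a n t" "\<And>n t. 0 \<le> b n t" "\<And>t. 0 \<le> s t" "\<And>t. 0 \<le> h t"
    and near: "\<And>n t. a n t \<le> b n t + s t" "\<And>n t. b n t \<le> a n t + s t"
    and int_a[simp]: "\<And>n. integrable \<mu> (\<lambda>t. a n t powr p)"
    and int_b[simp]: "\<And>n. integrable \<mu> (\<lambda>t. b n t powr p)"
    and int_s[simp]: "integrable \<mu> (\<lambda>t. s t powr p)"
    and int_h[simp]: "integrable \<mu> h"
    and bound: "\<And>n. (\<integral>t. a n t powr p \<partial>\<mu>) \<le> A"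
    and gap: "AE t in \<mu>. \<forall>\<^sub>F n in sequentially. a n t powr p + h t \<le> b n t powr p"
    and \<kappa>: "0 \<le> \<kappa>" "\<kappa> < (\<integral>t. h t \<partial>\<mu>)"
  shows "\<forall>\<^sub>F n in sequentially. (\<integral>t. a n t powr p \<partial>\<mu>) + \<kappa> \<le> (\<integral>t. b n t powr p \<partial>\<mu>)"
proof -
  define S H where "S = (\<integral>t. s t powr p \<partial>\<mu>)" and "H = (\<integral>t. h t \<partial>\<mu>)"
  define K where "K = 2 powr p * A + 2 powr p * S"
  have K: "(\<integral>t. b n t powr p \<partial>\<mu>) \<le> K" for n
  proof -
    have "(\<integral>t. b n t powr p \<partial>\<mu>) \<le> (\<integral>t. 2 powr p * a n t powr p + 2 powr p * s t powr p \<partial>\<mu>)"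
    proof (rule integral_mono)
      fix t
      have "b n t powr p \<le> (a n t + s t) powr p"
        using nonneg near p by (intro powr_mono2) auto
      also have "\<dots> \<le> 2 powr p * a n t powr p + 2 powr p * s t powr p"
        using powr_add_le_weighted[of "a n t" "s t" 1 p] nonneg p by simp
      finally show "b n t powr p \<le> 2 powr p * a n t powr p + 2 powr p * s t powr p" .
    qed auto
    also have "\<dots> = 2 powr p * (\<integral>t. a n t powr p \<partial>\<mu>) + 2 powr p * S"
      by (simp add: S_def)
    also have "\<dots> \<le> K"
      using bound by (simp add: K_def)
    finally show ?thesis .
  qed
  \<comment> \<open>half of the slack \<open>H - \<kappa>\<close> pays for the factor \<open>C\<close>, the other half for the limit inferior\<close>
  obtain \<theta> where \<theta>: "0 < \<theta>" "((1 + \<theta>) powr p - 1) * K \<le> (H - \<kappa>) / 2"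
    using powr_factor_near_one[of "(H - \<kappa>) / 2" p K] \<kappa> by (auto simp: H_def)
  define C D where "C = (1 + \<theta>) powr p" and "D = (1 + 1 / \<theta>) powr p"
  have C: "1 \<le> C" and D: "0 \<le> D"
    using \<theta> p by (auto simp: C_def D_def ge_one_powr_ge_zero)
  define g where "g n t = C * b n t powr p - a n t powr p + D * s t powr p" for n t
  have g_nonneg: "0 \<le> g n t" for n t
  proof -
    have "a n t powr p \<le> (b n t + s t) powr p"
      using nonneg near p by (intro powr_mono2) auto
    also have "\<dots> \<le> C * b n t powr p + D * s t powr p"
      unfolding C_def D_def using nonneg p \<theta> by (intro powr_add_le_weighted) auto
    finally show ?thesis by (simp add: g_def)
  qed
  have int_g: "integrable \<mu> (g n)" for n
    unfolding g_def by auto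
  have integral_g: "(\<integral>t. g n t \<partial>\<mu>) = C * (\<integral>t. b n t powr p \<partial>\<mu>) - (\<integral>t. a n t powr p \<partial>\<mu>) + D * S" for n
    unfolding g_def S_def by simp
  have "ennreal (H + D * S) = (\<integral>\<^sup>+t. ennreal (h t + D * s t powr p) \<partial>\<mu>)"
    using nonneg D by (subst nn_integral_eq_integral) (auto simp: H_def S_def)
  also have "\<dots> \<le> (\<integral>\<^sup>+t. liminf (\<lambda>n. ennreal (g n t)) \<partial>\<mu>)"
  proof (rule nn_integral_mono_AE, use gap in eventually_elim)
    case (elim t)
    then show ?case
    proof (intro Liminf_bounded, eventually_elim)
      case (elim n)
      have "1 * b n t powr p \<le> C * b n t powr p"
        using C by (intro mult_right_mono) auto
      then show ?case
        using elim by (intro ennreal_leI) (simp add: g_def)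
    qed
  qed
  also have "\<dots> \<le> liminf (\<lambda>n. \<integral>\<^sup>+t. ennreal (g n t) \<partial>\<mu>)"
    by (rule nn_integral_liminf) (use int_g in measurable)
  also have "\<dots> = liminf (\<lambda>n. ennreal (\<integral>t. g n t \<partial>\<mu>))"
    using int_g g_nonneg by (simp add: nn_integral_eq_integral)
  finally have fatou: "ennreal (H + D * S) \<le> liminf (\<lambda>n. ennreal (\<integral>t. g n t \<partial>\<mu>))" .
  have pos: "0 < (H + \<kappa>) / 2 + D * S"
    using nonneg D \<kappa> by (intro add_pos_nonneg) (auto simp: H_def S_def)
  have "ennreal ((H + \<kappa>) / 2 + D * S) < ennreal (H + D * S)"
  proof (rule ennreal_lessI)
    have "(H + \<kappa>) / 2 < H"
      using \<kappa> by (simp add: H_def)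
    then show "(H + \<kappa>) / 2 + D * S < H + D * S" "0 < H + D * S"
      using pos by linarith+
  qed
  then have "\<forall>\<^sub>F n in sequentially. ennreal ((H + \<kappa>) / 2 + D * S) < ennreal (\<integral>t. g n t \<partial>\<mu>)"
    using fatou by (intro less_LiminfD) (rule less_le_trans)
  then show ?thesis
  proof eventually_elim
    case (elim n)
    then have "(H + \<kappa>) / 2 + D * S < (\<integral>t. g n t \<partial>\<mu>)"
      using pos by (simp add: ennreal_less_iff)
    moreover have "(C - 1) * (\<integral>t. b n t powr p \<partial>\<mu>) \<le> (C - 1) * K"
      using K C by (intro mult_left_mono) auto
    moreover have "(C - 1) * K \<le> (H - \<kappa>) / 2"
      using \<theta>(2) by (simp add: C_def)
    moreover have "C * (\<integral>t. b n t powr p \<partial>\<mu>)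
        = (C - 1) * (\<integral>t. b n t powr p \<partial>\<mu>) + (\<integral>t. b n t powr p \<partial>\<mu>)"
      by (simp add: algebra_simps)
    ultimately show ?case
      unfolding integral_g by (simp add: add_divide_distrib diff_divide_distrib)
  qed
qed

section \<open>The spaces of Bochner \<open>p\<close>-integrable functions\<close>

lemma Bochner_measurable_diff:
  assumes "Bochner_measurable \<mu> f" "Bochner_measurable \<mu> g"
  shows "Bochner_measurable \<mu> (\<lambda>t. f t - g t)"
proof -
  obtain u v where u: "\<And>n::nat. simple_function \<mu> (u n)" "AE t in \<mu>. (\<lambda>n. u n t) \<longlonglongrightarrow> f t"
    and v: "\<And>n::nat. simple_function \<mu> (v n)" "AE t in \<mu>. (\<lambda>n. v n t) \<longlonglongrightarrow> g t"
    using assms by (auto simp: Bochner_measurable_def)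
  have "\<forall>n. simple_function \<mu> (\<lambda>t. u n t - v n t)"
    using u(1) v(1) by (auto intro: simple_function_diff)
  moreover have "AE t in \<mu>. (\<lambda>n. u n t - v n t) \<longlonglongrightarrow> f t - g t"
    using u(2) v(2) by eventually_elim (rule tendsto_diff)
  ultimately show ?thesis
    unfolding Bochner_measurable_def by (intro exI[of _ "\<lambda>n t. u n t - v n t"] conjI)
qed

text \<open>
  The norms of the approximating simple functions converge only almost everywhere, so their
  limit is a measurable function that agrees with \<open>norm (f t)\<close> outside a null set. Completeness
  makes measurability invariant under such a change.
\<close>
lemma (in complete_measure) Bochner_measurable_norm:
  assumes "Bochner_measurable M f"
  shows "(\<lambda>t. norm (f t)) \<in> borel_measurable M"
proof -
  obtain s where s: "\<And>n::nat. simple_function M (s n)" and lim: "AE t in M. (\<lambda>n. s n t) \<longlonglongrightarrow> f t"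
    using assms by (auto simp: Bochner_measurable_def)
  define g where "g t = lim (\<lambda>n. norm (s n t))" for t
  have [measurable]: "(\<lambda>t. norm (s n t)) \<in> borel_measurable M" for n
    using simple_function_compose[OF s, of norm n]
    by (auto intro: borel_measurable_simple_function simp: comp_def)
  have g[measurable]: "g \<in> borel_measurable M"
    unfolding g_def by measurable
  have eq: "AE t in M. g t = norm (f t)"
    using lim by eventually_elim (simp add: g_def limI tendsto_norm)
  show ?thesis
  proof (rule measurableI)
    fix B :: "real set" assume B: "B \<in> sets borel"
    show "(\<lambda>t. norm (f t)) -` B \<inter> space M \<in> sets M"
    proof (rule in_sets_AE)
      show "AE t in M. t \<in> g -` B \<inter> space M \<longleftrightarrow> t \<in> (\<lambda>t. norm (f t)) -` B \<inter> space M"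
        using eq by eventually_elim auto
    qed (use B in \<open>auto intro: measurable_sets[OF g]\<close>)
  qed simp
qed

lemma Lp_space_diff:
  assumes "complete_measure \<mu>" "0 \<le> p" and f: "f \<in> Lp_space p \<mu>" and g: "g \<in> Lp_space p \<mu>"
  shows "(\<lambda>t. f t - g t) \<in> Lp_space p \<mu>"
proof -
  have meas: "Bochner_measurable \<mu> (\<lambda>t. f t - g t)"
    using f g by (auto simp: Lp_space_def intro: Bochner_measurable_diff)
  have "integrable \<mu> (\<lambda>t. norm (f t - g t) powr p)"
  proof (rule Bochner_Integration.integrable_bound)
    show "integrable \<mu> (\<lambda>t. 2 powr p * norm (f t) powr p + 2 powr p * norm (g t) powr p)"
      using f g by (auto simp: Lp_space_def)
    show "(\<lambda>t. norm (f t - g t) powr p) \<in> borel_measurable \<mu>"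
      using complete_measure.Bochner_measurable_norm[OF assms(1) meas] by measurable
    show "AE t in \<mu>. norm (norm (f t - g t) powr p)
        \<le> norm (2 powr p * norm (f t) powr p + 2 powr p * norm (g t) powr p)"
    proof (rule AE_I2)
      fix t
      have "norm (f t - g t) powr p \<le> (norm (f t) + norm (g t)) powr p"
        using assms(2) by (intro powr_mono2) (auto simp: norm_triangle_ineq4)
      also have "\<dots> \<le> 2 powr p * norm (f t) powr p + 2 powr p * norm (g t) powr p"
        using powr_add_le_weighted[of "norm (f t)" "norm (g t)" 1 p] assms(2) by simp
      finally show "norm (norm (f t - g t) powr p)
          \<le> norm (2 powr p * norm (f t) powr p + 2 powr p * norm (g t) powr p)"
        by simp
    qed
  qed
  with meas show ?thesis
    by (simp add: Lp_space_def)
qed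

lemma Lp_norm_powr:
  assumes "p \<noteq> 0"
  shows "Lp_norm p \<mu> f powr p = (\<integral>t. norm (f t) powr p \<partial>\<mu>)"
  using assms by (simp add: Lp_norm_def powr_powr)

text \<open>
  The norm is recovered as a root of its integrable power, so membership in the space
  yields its measurability.
\<close>
lemma norm_measurable_if_Lp_space:
  assumes "f \<in> Lp_space p \<mu>" "p \<noteq> 0"
  shows "(\<lambda>t. norm (f t)) \<in> borel_measurable \<mu>"
proof -
  have "(\<lambda>t. norm (f t) powr p) \<in> borel_measurable \<mu>"
    using assms by (auto simp: Lp_space_def)
  then have "(\<lambda>t. (norm (f t) powr p) powr (1 / p)) \<in> borel_measurable \<mu>"
    by measurable
  then show ?thesis
    using assms(2) by (simp add: powr_powr)
qed

lemma (in finite_measure) nonzero_imp_large_on_positive_measure: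
  assumes [measurable]: "(\<lambda>t. norm (f t)) \<in> borel_measurable M" and "\<not> (AE t in M. f t = 0)"
  obtains c where "0 < c" "0 < measure M {t \<in> space M. c \<le> norm (f t)}"
proof -
  have "\<exists>n::nat. 0 < measure M {t \<in> space M. 1 / Suc n \<le> norm (f t)}"
  proof (rule ccontr)
    assume "\<nexists>n::nat. 0 < measure M {t \<in> space M. 1 / Suc n \<le> norm (f t)}"
    then have "measure M {t \<in> space M. 1 / Suc n \<le> norm (f t)} = 0" for n :: nat
      by (metis measure_nonneg order_less_le)
    then have "AE t in M. \<not> 1 / Suc n \<le> norm (f t)" for n :: nat
      by (intro AE_I'[of "{t \<in> space M. 1 / Suc n \<le> norm (f t)}"])
        (auto simp: null_sets_def emeasure_eq_measure)
    then have "AE t in M. \<forall>n::nat. norm (f t) < 1 / Suc n"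
      by (simp add: AE_all_countable not_le)
    then have "AE t in M. f t = 0"
    proof eventually_elim
      case (elim t)
      then show ?case
        using nat_approx_posE[of "norm (f t)"] by (metis norm_le_zero_iff not_le less_asym)
    qed
    then show False
      using assms(2) by simp
  qed
  then show ?thesis
    using that[of "1 / Suc _"] by auto
qed

section \<open>The gap of the norms\<close>

theorem theorem4p3:
  fixes \<mu> :: "'s measure" and p M R :: real and f :: "'s \<Rightarrow> 'b::banach"
  assumes "finite_measure \<mu>" and "complete_measure \<mu>"
    and "1 \<le> p"
    and "uniform_Opial TYPE('b)"
    and "M > 0" and "R > 0"
    and "f \<in> Lp_space p \<mu>" and "\<not> (AE t in \<mu>. f t = 0)"
  shows "\<exists>\<eta>>0. \<forall>F :: nat \<Rightarrow> 's \<Rightarrow> 'b.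
    (\<forall>n. F n \<in> Lp_space p \<mu>) \<longrightarrow>
    (SUP n. ereal (Lp_norm p \<mu> (F n))) \<le> ereal R \<longrightarrow>
    (AE t in \<mu>. weakly_null (\<lambda>n. F n t) \<and>
       (\<exists>l. (\<lambda>n. norm (F n t)) \<longlonglongrightarrow> l \<and> l \<le> M)) \<longrightarrow>
    limsup (\<lambda>n. ereal (Lp_norm p \<mu> (F n))) + ereal \<eta>
      \<le> limsup (\<lambda>n. ereal (Lp_norm p \<mu> (\<lambda>t. F n t - f t)))"
proof -
  interpret finite_measure \<mu> by fact
  have f_meas[measurable]: "(\<lambda>t. norm (f t)) \<in> borel_measurable \<mu>"
    using assms by (intro norm_measurable_if_Lp_space[of _ p]) auto
  obtain c where c: "0 < c" "0 < measure \<mu> {t \<in> space \<mu>. c \<le> norm (f t)}"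
    using nonzero_imp_large_on_positive_measure[OF f_meas] assms(8) by blast
  define E where "E = {t \<in> space \<mu>. c \<le> norm (f t)}"
  have E[measurable]: "E \<in> sets \<mu>"
    unfolding E_def by measurable
  obtain \<delta> where \<delta>: "0 < \<delta>"
    and \<delta>_gap: "\<And>(x::'b) xs l. c \<le> norm x \<Longrightarrow> weakly_null xs \<Longrightarrow> (\<lambda>n. norm (xs n)) \<longlonglongrightarrow> l \<Longrightarrow> l \<le> M
       \<Longrightarrow> \<forall>\<^sub>F n in sequentially. norm (xs n) + \<delta> \<le> norm (xs n - x)"
    by (rule uniform_Opial_eventually_gap[OF assms(4) c(1) assms(5)]) (rule that)
  define h where "h t = \<delta> powr p * indicator E t" for t
  define \<kappa> where "\<kappa> = \<delta> powr p * measure \<mu> E / 2"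
  have \<kappa>: "0 < \<kappa>"
    using c \<delta> by (simp add: \<kappa>_def E_def)
  have int_h: "integrable \<mu> h" "(\<integral>t. h t \<partial>\<mu>) = \<delta> powr p * measure \<mu> E"
    unfolding h_def using E by (simp_all add: integrable_real_indicator emeasure_eq_measure)
  obtain \<eta> where \<eta>: "0 < \<eta>" and \<eta>_gap:
    "\<And>x y. 0 \<le> x \<Longrightarrow> x \<le> R \<Longrightarrow> 0 \<le> y \<Longrightarrow> x powr p + \<kappa> \<le> y powr p \<Longrightarrow> x + \<eta> \<le> y"
    by (rule powr_gap_imp_gap[OF assms(3) \<kappa>]) (rule that)
  show ?thesis
  proof (intro exI[of _ \<eta>] conjI allI impI)
    fix F :: "nat \<Rightarrow> 's \<Rightarrow> 'b"
    assume F: "\<forall>n. F n \<in> Lp_space p \<mu>" and sup: "(SUP n. ereal (Lp_norm p \<mu> (F n))) \<le> ereal R"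
      and F_lim: "AE t in \<mu>. weakly_null (\<lambda>n. F n t) \<and> (\<exists>l. (\<lambda>n. norm (F n t)) \<longlonglongrightarrow> l \<and> l \<le> M)"
    have bound: "Lp_norm p \<mu> (F n) \<le> R" for n
      using sup by (auto simp: SUP_le_iff)
    have "\<forall>\<^sub>F n in sequentially. (\<integral>t. norm (F n t) powr p \<partial>\<mu>) + \<kappa> \<le> (\<integral>t. norm (F n t - f t) powr p \<partial>\<mu>)"
    proof (rule eventually_integral_powr_gap)
      show "integrable \<mu> (\<lambda>t. norm (F n t) powr p)" for n
        using F by (simp add: Lp_space_def)
      show "integrable \<mu> (\<lambda>t. norm (F n t - f t) powr p)" for n
        using Lp_space_diff[OF assms(2) _ _ assms(7), of "F n"] F assms(3) by (simp add: Lp_space_def)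
      show "integrable \<mu> (\<lambda>t. norm (f t) powr p)"
        using assms(7) by (simp add: Lp_space_def)
      show "(\<integral>t. norm (F n t) powr p \<partial>\<mu>) \<le> R powr p" for n
      proof -
        have "0 \<le> Lp_norm p \<mu> (F n)"
          by (simp add: Lp_norm_def)
        then have "Lp_norm p \<mu> (F n) powr p \<le> R powr p"
          using bound[of n] assms(3) by (intro powr_mono2) auto
        then show ?thesis
          using assms(3) by (simp add: Lp_norm_powr)
      qed
      show "\<kappa> < (\<integral>t. h t \<partial>\<mu>)" "0 \<le> \<kappa>"
        using \<kappa> unfolding int_h by (simp_all add: \<kappa>_def mult.commute)
      show "AE t in \<mu>. \<forall>\<^sub>F n in sequentially. norm (F n t) powr p + h t \<le> norm (F n t - f t) powr p"
        using F_lim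
      proof eventually_elim
        case (elim t)
        then obtain l where l: "weakly_null (\<lambda>n. F n t)" "(\<lambda>n. norm (F n t)) \<longlonglongrightarrow> l" "l \<le> M"
          by blast
        consider "t \<in> E" | "t \<notin> E" "f t = 0" | "t \<notin> E" "f t \<noteq> 0"
          by blast
        then show ?case
        proof cases
          case 1
          then have "c \<le> norm (f t)" by (simp add: E_def)
          from \<delta>_gap[OF this l] show ?thesis
          proof eventually_elim
            case (elim n)
            have "norm (F n t) powr p + h t \<le> (norm (F n t) + \<delta>) powr p"
              using 1 \<delta> assms(3) powr_add_ge[of "norm (F n t)" \<delta> p] by (simp add: h_def)
            also have "\<dots> \<le> norm (F n t - f t) powr p"
              using elim \<delta> assms(3) by (intro powr_mono2) auto
            finally show ?case .
          qed
        next
          case 2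
          then show ?thesis by (simp add: h_def)
        next
          \<comment> \<open>\<open>h t = 0\<close>, so any positive gap will do and it may depend on \<open>t\<close>\<close>
          case 3
          then have f_pos: "0 < norm (f t)" by simp
          obtain \<delta>' where "0 < \<delta>'"
            "\<forall>\<^sub>F n in sequentially. norm (F n t) + \<delta>' \<le> norm (F n t - f t)"
            by (rule uniform_Opial_eventually_gap[OF assms(4) f_pos assms(5)])
              (use l in \<open>blast intro: that\<close>)
          from this(2) show ?thesis
          proof eventually_elim
            case (elim n)
            then show ?case
              using \<open>0 < \<delta>'\<close> 3 assms(3) by (simp add: h_def powr_mono2)
          qed
        qed
      qed
      show "norm (F n t) \<le> norm (F n t - f t) + norm (f t)" for n t
        using norm_triangle_sub[of "F n t" "f t"] by simp
      show "integrable \<mu> h"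
        by (rule int_h(1))
    qed (use assms(3) in \<open>auto simp: h_def norm_triangle_ineq4\<close>)
    then have "\<forall>\<^sub>F n in sequentially. Lp_norm p \<mu> (F n) + \<eta> \<le> Lp_norm p \<mu> (\<lambda>t. F n t - f t)"
    proof eventually_elim
      case (elim n)
      show ?case
        using elim assms(3) bound[of n]
        by (intro \<eta>_gap) (auto simp: Lp_norm_powr, auto simp: Lp_norm_def)
    qed
    then have "limsup (\<lambda>n. ereal (Lp_norm p \<mu> (F n)) + ereal \<eta>)
        \<le> limsup (\<lambda>n. ereal (Lp_norm p \<mu> (\<lambda>t. F n t - f t)))"
      by (intro Limsup_mono) simp
    then show "limsup (\<lambda>n. ereal (Lp_norm p \<mu> (F n))) + ereal \<eta>
        \<le> limsup (\<lambda>n. ereal (Lp_norm p \<mu> (\<lambda>t. F n t - f t)))"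
      by (subst (asm) Limsup_add_ereal_right) simp_all
  qed (rule \<eta>)
qed

end
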